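(* Let $k\ge 3$ and $n\ge 1$ be integers, and let $\mathcal{H}(n,k)$ be the hierarchical graph, with $N_n=k^n$ vertices. The second-order network coherence of $\mathcal{H}(n,k)$ is $$H_2(\mathcal{H}(n,k))=\frac{k-k^2+k^n(k^2-5k-6)+k^{2n}(4k+6)}{2k^{n+3}(1+k)}+\frac{2n(1-k)}{k^3}.$$ Moreover, for fixed $k$, as $n\to\infty$, $$H_2(\mathcal{H}(n,k))\sim \frac{2k+3}{k^3(k+1)}N_n,$$ i.e. the ratio of the two sides tends to $1$.
   Context: Hierarchical graphs: for $k\ge 3$, $\mathcal{H}(1,k)$ is the complete graph $\mathcal{K}_k$ on $k$ vertices. For $n>1$, $\mathcal{H}(n,k)$ is obtained from $\mathcal{H}(n-1,k)$ as follows: for each vertex $v$ of $\mathcal{H}(n-1,k)$, create a new complete graph $\mathcal{K}_{k-1}$ (on $k-1$ new vertices) and join all its $k-1$ vertices to $v$. Second-order network coherence: let $\mathcal{G}$ be a connected undirected graph with $N$ vertices and Laplacian matrix $\mathbf{L}=\mathbf{D}-\mathbf{A}$ (degree matrix minus adjacency matrix), with eigenvalues $0=\lambda_1<\lambda_2\le\cdots\le\lambda_N$. Consider the dynamics $\dot x(t)=v(t)$, $\dot v(t)=-\mathbf{L}x(t)-\mathbf{L}v(t)+w(t)$ with positions $x(t)\in\mathbb{R}^N$, velocities $v(t)\in\mathbb{R}^N$, and $w(t)\in\mathbb{R}^N$ a mutually uncorrelated (unit-intensity) white noise process. The second-order network coherence $H_2(\mathcal{G})$ is the mean (over vertices) steady-state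 variance of the deviation of each vertex's position from the average of all positions. It is a known fact, which may be taken as the definition of $H_2$, that $H_2(\mathcal{G})=\frac{1}{2N}\sum_{i=2}^{N}\frac{1}{\lambda_i^2}$. *)

theory Defs
  imports
    "HOL-Library.Landau_Symbols"
    "Graph_Theory.Digraph_Component"
    "Jordan_Normal_Form.Char_Poly"
begin

text \<open>
  As usual in Graph_Theory, an undirected simple graph is a symmetric loop-free digraph,
  each undirected edge being represented by its two arcs.
\<close>

definition complete_on :: "'a set \<Rightarrow> 'a pair_pre_digraph" where
  "complete_on A = \<lparr> pverts = A, parcs = {(u, w) \<in> A \<times> A. u \<noteq> w} \<rparr>"

text \<open>
  Names of the vertices of the clique that is attached to \<open>v\<close>. For a graph on the vertices
  \<open>{..<N}\<close> they are fresh, and different \<open>v\<close> get disjoint sets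
  (see \<open>new_vertices_fresh\<close> and \<open>new_vertices_disjoint\<close> below).
\<close>

definition new_vertices :: "nat \<Rightarrow> nat \<Rightarrow> nat \<Rightarrow> nat set" where
  "new_vertices N k v = (\<lambda>j. v + j * N) ` {1..<k}"

definition attach_cliques :: "nat \<Rightarrow> nat pair_pre_digraph \<Rightarrow> nat pair_pre_digraph" where
  "attach_cliques k G =
    (let C = new_vertices (card (pverts G)) k in
     \<lparr> pverts = pverts G \<union> (\<Union>v\<in>pverts G. pverts (complete_on (C v))),
       parcs = parcs G \<union>
         (\<Union>v\<in>pverts G. parcs (complete_on (C v)) \<union> {v} \<times> C v \<union> C v \<times> {v}) \<rparr>)"

text \<open>The case \<open>n = 0\<close> is a dummy; the hierarchical graphs start with \<open>n = 1\<close>.\<close>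

fun hierarchical_graph :: "nat \<Rightarrow> nat \<Rightarrow> nat pair_pre_digraph" where
  "hierarchical_graph 0 k = complete_on {..<1}"
| "hierarchical_graph (Suc 0) k = complete_on {..<k}"
| "hierarchical_graph (Suc (Suc n)) k = attach_cliques k (hierarchical_graph (Suc n) k)"

definition degree_matrix :: "'a::linorder pair_pre_digraph \<Rightarrow> real mat" where
  "degree_matrix G =
    (let vs = sorted_list_of_set (pverts G); N = length vs in
     mat N N (\<lambda>(i, j). if i = j then real (out_degree G (vs ! i)) else 0))"

definition adjacency_matrix :: "'a::linorder pair_pre_digraph \<Rightarrow> real mat" where
  "adjacency_matrix G =
    (let vs = sorted_list_of_set (pverts G); N = length vs in
     mat N N (\<lambda>(i, j). if (vs ! i, vs ! j) \<in> parcs G then 1 else 0))"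

definition laplacian_matrix :: "'a::linorder pair_pre_digraph \<Rightarrow> real mat" where
  "laplacian_matrix G = degree_matrix G - adjacency_matrix G"

text \<open>
  The eigenvalues \<open>\<lambda>\<^sub>1 \<le> \<dots> \<le> \<lambda>\<^sub>N\<close> of the Laplacian, with multiplicity. The Laplacian of an
  undirected graph is real symmetric, so all \<open>N\<close> complex roots of its characteristic
  polynomial are real and hence occur here.
\<close>

definition laplacian_eigenvalue :: "'a::linorder pair_pre_digraph \<Rightarrow> nat \<Rightarrow> real" where
  "laplacian_eigenvalue G i =
    sorted_list_of_multiset (proots (char_poly (laplacian_matrix G))) ! (i - 1)"

text \<open>Second-order network coherence of a connected graph, through its spectral formula.\<close>

definition coherence2 :: "'a::linorder pair_pre_digraph \<Rightarrow> real" where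
  "coherence2 G =
    (let N = card (pverts G) in
     1 / (2 * real N) * (\<Sum>i=2..N. 1 / (laplacian_eigenvalue G i)\<^sup>2))"


subsection \<open>The hierarchical graphs are connected simple graphs on \<open>k ^ n\<close> vertices\<close>

lemma new_vertices_fresh:
  assumes "v < N" shows "new_vertices N k v \<inter> {..<N} = {}"
proof -
  have "N \<le> v + j * N" if "j \<ge> 1" for j
    using mult_le_mono1[OF that, of N] by linarith
  then show ?thesis
    by (fastforce simp: new_vertices_def)
qed

lemma new_vertices_mod: "u \<in> new_vertices N k v \<Longrightarrow> v < N \<Longrightarrow> u mod N = v"
  by (auto simp: new_vertices_def)

lemma new_vertices_disjoint:
  assumes "v < N" "w < N" "v \<noteq> w"
  shows "new_vertices N k v \<inter> new_vertices N k w = {}"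
  using assms new_vertices_mod by blast

lemma card_new_vertices:
  assumes "v < N" shows "card (new_vertices N k v) = k - 1"
proof -
  have "inj_on (\<lambda>j. v + j * N) {1..<k}"
    using assms by (auto simp: inj_on_def)
  then show ?thesis
    by (simp add: new_vertices_def card_image)
qed

lemma union_new_vertices:
  assumes "k \<ge> 1"
  shows "{..<N} \<union> (\<Union>v\<in>{..<N}. new_vertices N k v) = {..<k * N}"
proof (intro equalityI subsetI)
  fix u assume "u \<in> {..<N} \<union> (\<Union>v\<in>{..<N}. new_vertices N k v)"
  then consider "u < N" | v j where "v < N" "1 \<le> j" "j < k" "u = v + j * N"
    by (auto simp: new_vertices_def)
  then show "u \<in> {..<k * N}"
  proof cases
    case 1
    have "1 * N \<le> k * N" using assms by (intro mult_le_mono) auto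
    then show ?thesis using 1 by (simp only: lessThan_iff)
  next
    case 2
    have "Suc j * N \<le> k * N" using 2 by (intro mult_le_mono) auto
    then show ?thesis using 2 by simp
  qed
next
  fix u assume u: "u \<in> {..<k * N}"
  then have "N > 0" by (cases N) auto
  show "u \<in> {..<N} \<union> (\<Union>v\<in>{..<N}. new_vertices N k v)"
  proof (cases "u < N")
    case False
    have "u = u mod N + (u div N) * N" by simp
    moreover have "u div N \<in> {1..<k}"
      using u False \<open>N > 0\<close> by (auto simp: less_mult_imp_div_less Suc_le_eq div_greater_zero_iff)
    ultimately have "u \<in> new_vertices N k (u mod N)"
      unfolding new_vertices_def by blast
    then show ?thesis using \<open>N > 0\<close> by auto
  qed simp
qed

lemma pverts_hierarchical_graph:
  assumes "k \<ge> 1"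
  shows "pverts (hierarchical_graph n k) = {..<k ^ n}"
proof (induction n k rule: hierarchical_graph.induct)
  case (3 n k)
  show ?case
  proof (cases "k = 0")
    case False
    then show ?thesis
      using 3 union_new_vertices[of k "k ^ Suc n"]
      by (simp add: attach_cliques_def complete_on_def Let_def)
  qed (use 3 in \<open>simp add: attach_cliques_def complete_on_def\<close>)
qed (auto simp: complete_on_def)

lemma card_hierarchical_graph:
  "k \<ge> 1 \<Longrightarrow> card (pverts (hierarchical_graph n k)) = k ^ n"
  by (simp add: pverts_hierarchical_graph)

lemma hierarchical_graph_arcs:
  assumes "k \<ge> 1"
  shows "parcs (hierarchical_graph n k) \<subseteq> {..<k ^ n} \<times> {..<k ^ n}"
    and "sym (parcs (hierarchical_graph n k))"
    and "irrefl (parcs (hierarchical_graph n k))"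
proof -
  have "parcs (hierarchical_graph n k) \<subseteq> {..<k ^ n} \<times> {..<k ^ n} \<and>
    sym (parcs (hierarchical_graph n k)) \<and> irrefl (parcs (hierarchical_graph n k))"
    using assms
  proof (induction n k rule: hierarchical_graph.induct)
    case (3 n k)
    let ?G = "hierarchical_graph (Suc n) k" and ?N = "k ^ Suc n"
    let ?C = "new_vertices ?N k"
    have arcs: "parcs (hierarchical_graph (Suc (Suc n)) k) = parcs ?G \<union>
        (\<Union>v\<in>{..<?N}. {(u, w) \<in> ?C v \<times> ?C v. u \<noteq> w} \<union> {v} \<times> ?C v \<union> ?C v \<times> {v})"
      using 3(2) by (simp add: attach_cliques_def complete_on_def Let_def
          pverts_hierarchical_graph del: power_Suc)
    have C: "{..<?N} \<union> (\<Union>v\<in>{..<?N}. ?C v) = {..<k ^ Suc (Suc n)}"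
      using union_new_vertices[OF 3(2), of ?N] by simp
    have IH: "parcs ?G \<subseteq> {..<?N} \<times> {..<?N}" "sym (parcs ?G)" "irrefl (parcs ?G)"
      using 3 by blast+
    have "parcs (hierarchical_graph (Suc (Suc n)) k) \<subseteq> {..<k ^ Suc (Suc n)} \<times> {..<k ^ Suc (Suc n)}"
      unfolding arcs C[symmetric] using IH(1) by blast
    moreover have "sym (parcs (hierarchical_graph (Suc (Suc n)) k))"
      unfolding arcs using IH(2) by (auto simp: sym_def)
    moreover have "irrefl (parcs (hierarchical_graph (Suc (Suc n)) k))"
      unfolding arcs irrefl_def using IH(3) new_vertices_fresh[of _ ?N k]
      by (fastforce simp: irrefl_def simp del: power_Suc)
    ultimately show ?case by blast
  qed (auto simp: complete_on_def sym_def irrefl_def)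
  then show "parcs (hierarchical_graph n k) \<subseteq> {..<k ^ n} \<times> {..<k ^ n}"
    "sym (parcs (hierarchical_graph n k))" "irrefl (parcs (hierarchical_graph n k))"
    by blast+
qed

lemma pair_graph_hierarchical_graph:
  assumes "k \<ge> 1" shows "pair_graph (hierarchical_graph n k)"
proof -
  note arcs = hierarchical_graph_arcs[OF assms, of n]
  have "finite (parcs (hierarchical_graph n k))"
    using arcs(1) by (rule finite_subset) simp
  then show ?thesis
    using arcs assms
    by unfold_locales
      (auto simp: pverts_hierarchical_graph symmetric_def irrefl_def)
qed

lemma connected_hierarchical_graph:
  assumes "k \<ge> 1" shows "connected (hierarchical_graph n k)"
proof -
  have reach: "(u, w) \<in> (parcs (hierarchical_graph n k))\<^sup>*" if "u < k ^ n" "w < k ^ n" for u w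
    using assms that
  proof (induction n k arbitrary: u w rule: hierarchical_graph.induct)
    case (2 k)
    then show ?case by (cases "u = w") (auto simp: complete_on_def)
  next
    case (3 n k)
    let ?G = "hierarchical_graph (Suc n) k" and ?N = "k ^ Suc n"
    let ?R = "parcs (hierarchical_graph (Suc (Suc n)) k)"
    let ?C = "new_vertices ?N k"
    have arcs: "?R = parcs ?G \<union>
        (\<Union>v\<in>{..<?N}. {(u, w) \<in> ?C v \<times> ?C v. u \<noteq> w} \<union> {v} \<times> ?C v \<union> ?C v \<times> {v})"
      using 3(2) by (simp add: attach_cliques_def complete_on_def Let_def
          pverts_hierarchical_graph del: power_Suc)
    have old: "(a, b) \<in> ?R\<^sup>*" if "a < ?N" "b < ?N" for a b
      using 3(1)[OF 3(2) that] rtrancl_mono[of "parcs ?G" ?R] unfolding arcs by blast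
    have near: "\<exists>a<?N. (a, b) \<in> ?R\<^sup>* \<and> (b, a) \<in> ?R\<^sup>*" if "b < k ^ Suc (Suc n)" for b
    proof -
      have "b \<in> {..<?N} \<union> (\<Union>v\<in>{..<?N}. ?C v)"
        using that union_new_vertices[OF 3(2), of ?N] by simp
      then consider "b < ?N" | v where "v < ?N" "b \<in> ?C v" by blast
      then show ?thesis
      proof cases
        case 2
        then have "(v, b) \<in> ?R" "(b, v) \<in> ?R" unfolding arcs by blast+
        then show ?thesis using 2 by blast
      qed blast
    qed
    obtain a b where "a < ?N" "(u, a) \<in> ?R\<^sup>*" "b < ?N" "(b, w) \<in> ?R\<^sup>*"
      using near 3(3,4) by blast
    with old show ?case by (meson rtrancl_trans)
  qed simp
  interpret pair_graph "hierarchical_graph n k"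
    using assms by (rule pair_graph_hierarchical_graph)
  have "strongly_connected (hierarchical_graph n k)"
  proof (rule strongly_connectedI)
    show "verts (hierarchical_graph n k) \<noteq> {}"
      using assms by (simp add: pverts_hierarchical_graph lessThan_empty_iff)
    fix u w assume "u \<in> verts (hierarchical_graph n k)" "w \<in> verts (hierarchical_graph n k)"
    then have uw: "u < k ^ n" "w < k ^ n" using assms by (auto simp: pverts_hierarchical_graph)
    have "(u, x) \<in> rtrancl_on (pverts (hierarchical_graph n k)) (parcs (hierarchical_graph n k))"
      if "(u, x) \<in> (parcs (hierarchical_graph n k))\<^sup>*" for x
      using that
    proof (induction rule: rtrancl_induct)
      case base
      then show ?case using uw assms by (auto simp: pverts_hierarchical_graph)
    next
      case (step y z)
      have "z \<in> pverts (hierarchical_graph n k)"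
        using step.hyps hierarchical_graph_arcs(1)[OF assms, of n] assms
        by (auto simp: pverts_hierarchical_graph)
      with step show ?case by (meson rtrancl_on_into_rtrancl_on)
    qed
    with reach[OF uw] show "u \<rightarrow>\<^sup>*\<^bsub>with_proj (hierarchical_graph n k)\<^esub> w"
      by (auto simp: reachable_def)
  qed
  moreover have "mk_symmetric (hierarchical_graph n k) = hierarchical_graph n k"
    using hierarchical_graph_arcs(2)[OF assms, of n]
    by (intro pair_pre_digraph.equality) (auto simp: mk_symmetric_def dest: symD)
  ultimately show ?thesis
    by (simp add: connected_def)
qed

end

theory Submission
  imports Defs
begin

text \<open>
  Write \<open>N\<close> for the number of vertices of \<open>G\<close> and let \<open>G'\<close> arise from \<open>G\<close> by attaching a clique to each
  vertex. Vertices of \<open>G'\<close> congruent modulo \<open>N\<close> form a copy of \<open>K\<^sub>k\<close>, so the Laplacians are related by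
  \<open>L' = k I - E E\<^sup>T + F L F\<^sup>T\<close>, where \<open>E\<close> is the incidence matrix of the residue map and \<open>F\<close> that of
  the inclusion. Two applications of \<open>det (I - A B) = det (I - B A)\<close> give
  \<open>p'(t) = (t - k)\<^bsup>(k-2)N\<^esup> (t - 1)\<^bsup>N\<^esup> p(t (t - k) / (t - 1))\<close> for the characteristic polynomials. Hence the
  eigenvalue \<open>0\<close> of \<open>G\<close> yields \<open>0\<close> and \<open>k\<close>, an eigenvalue \<open>\<lambda> > 0\<close> yields the two positive roots of
  \<open>x\<^sup>2 - (\<lambda> + k) x + \<lambda>\<close>, and \<open>k\<close> occurs another \<open>(k - 2) N\<close> times. By Vieta this is a linear recursion
  for the sums of \<open>1 / \<lambda>\<close> and \<open>1 / \<lambda>\<^sup>2\<close> over the nonzero eigenvalues, which is solved by induction.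
\<close>

section \<open>Determinants of low-rank updates\<close>

text \<open>The matrix \<open>?P\<close> times the unipotent \<open>?Q\<close>, in either order, is
  block upper triangular. The two orders leave \<open>1 - A * B\<close> and \<open>1 - B * A\<close>
  on the diagonal, and both products have the same determinant.\<close>

lemma det_one_minus_mult_commute:
  fixes A B :: "'a :: idom mat"
  assumes A: "A \<in> carrier_mat m n" and B: "B \<in> carrier_mat n m"
  shows "det (1\<^sub>m m - A * B) = det (1\<^sub>m n - B * A)"
proof -
  let ?P = "four_block_mat (1\<^sub>m m) A B (1\<^sub>m n)"
  let ?Q = "four_block_mat (1\<^sub>m m) (0\<^sub>m m n) (- B) (1\<^sub>m n)"
  have carrier: "?P \<in> carrier_mat (m + n) (m + n)" "?Q \<in> carrier_mat (m + n) (m + n)"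
    by simp_all
  have blocks: "A * - B = - (A * B)" "- B * A = - (B * A)"
    using A B by simp_all
  have "?P * ?Q = four_block_mat (1\<^sub>m m - A * B) A (0\<^sub>m n m) (1\<^sub>m n)"
    using A B
    by (subst mult_four_block_mat[of _ m m _ n _ n _ _ m _ n])
      (simp_all add: blocks add_uminus_minus_mat[of _ m m] comm_add_mat[of B n m])
  then have "det (?P * ?Q) = det (1\<^sub>m m - A * B)"
    using A B by (simp add: det_four_block_mat_lower_left_zero[of _ m _ n] minus_carrier_mat)
  moreover have "?Q * ?P = four_block_mat (1\<^sub>m m) A (0\<^sub>m n m) (1\<^sub>m n - B * A)"
    using A B
    by (subst mult_four_block_mat[of _ m m _ n _ n _ _ m _ n])
      (simp_all add: blocks uminus_l_inv_mat[of _ n m] comm_add_mat[of "- (B * A)" n n]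
        add_uminus_minus_mat[of _ n n])
  then have "det (?Q * ?P) = det (1\<^sub>m n - B * A)"
    using A B by (simp add: det_four_block_mat_lower_left_zero[of _ m _ n] minus_carrier_mat)
  moreover have "det (?P * ?Q) = det (?Q * ?P)"
    using carrier by (simp add: det_mult[of _ "m + n"] mult.commute)
  ultimately show ?thesis by simp
qed

text \<open>Evaluation at a scalar moves the later computations from polynomial matrices to matrices
  over the field, where division by expressions in \<open>t\<close> is available.\<close>

lemma poly_char_poly:
  fixes A :: "'a :: field mat"
  assumes A: "A \<in> carrier_mat n n"
  shows "poly (char_poly A) t = det (t \<cdot>\<^sub>m 1\<^sub>m n - A)"
  unfolding char_poly_def
  by (rule poly_det_cong[of _ n]) (use A in \<open>auto simp: char_poly_matrix_def\<close>)

text \<open>After pulling out \<open>s\<close>, swapping the factors replaces \<open>A * B\<close>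
  by the scalar matrix \<open>B * A\<close>.\<close>

lemma det_scaled_one_add_mult:
  fixes A B :: "'a :: field mat"
  assumes A: "A \<in> carrier_mat m n" and B: "B \<in> carrier_mat n m" and s: "s \<noteq> 0"
    and BA: "B * A = c \<cdot>\<^sub>m 1\<^sub>m n"
  shows "det (s \<cdot>\<^sub>m 1\<^sub>m m + A * B) = s ^ m * (1 + c / s) ^ n"
proof -
  let ?A = "(- 1 / s) \<cdot>\<^sub>m A"
  have "s \<cdot>\<^sub>m 1\<^sub>m m + A * B = s \<cdot>\<^sub>m (1\<^sub>m m - ?A * B)"
    using A B s by (intro eq_matI) (auto simp: algebra_simps)
  then have "det (s \<cdot>\<^sub>m 1\<^sub>m m + A * B) = s ^ m * det (1\<^sub>m m - ?A * B)"
    using A B by simp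
  also have "det (1\<^sub>m m - ?A * B) = det (1\<^sub>m n - B * ?A)"
    using A B by (intro det_one_minus_mult_commute) auto
  also have "1\<^sub>m n - B * ?A = (1 + c / s) \<cdot>\<^sub>m 1\<^sub>m n"
    using A B BA s by (subst mult_smult_distrib) (auto intro!: eq_matI)
  finally show ?thesis by simp
qed

text \<open>The matrix \<open>Y = s I + E * transpose_mat E\<close> has an explicit inverse. Once it
  is factored out, swapping factors reduces the size from \<open>m\<close> to \<open>n\<close>, and
  \<open>L\<close> is only scaled because the compression of that inverse by \<open>F\<close> is a
  scalar matrix.\<close>

lemma det_rank_update_compression:
  fixes L E F :: "'a :: field mat"
  assumes L: "L \<in> carrier_mat n n" and E: "E \<in> carrier_mat m n" and F: "F \<in> carrier_mat m n"
    and EE: "transpose_mat E * E = c \<cdot>\<^sub>m 1\<^sub>m n" and FF: "transpose_mat F * F = 1\<^sub>m n"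
    and FE: "transpose_mat F * E = 1\<^sub>m n" and EF: "transpose_mat E * F = 1\<^sub>m n"
    and s: "s \<noteq> 0" "s + c \<noteq> 0"
  shows "det (s \<cdot>\<^sub>m 1\<^sub>m m + E * transpose_mat E - F * L * transpose_mat F) =
    s ^ m * ((s + c) / s) ^ n * det (1\<^sub>m n - ((s + c - 1) / (s * (s + c))) \<cdot>\<^sub>m L)"
proof -
  define t where "t = s + c"
  define P where "P = E * transpose_mat E"
  define Y where "Y = s \<cdot>\<^sub>m 1\<^sub>m m + P"
  \<comment> \<open>the inverse of \<open>Y\<close>, because \<open>P\<^sup>2 = c P\<close>\<close>
  define Z where "Z = (1 / s) \<cdot>\<^sub>m (1\<^sub>m m - (1 / t) \<cdot>\<^sub>m P)"
  define FT where "FT = transpose_mat F"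
  define ET where "ET = transpose_mat E"
  have t: "t \<noteq> 0" using s by (simp add: t_def)
  have FT: "FT \<in> carrier_mat n m" using F by (simp add: FT_def)
  have ET: "ET \<in> carrier_mat n m" using E by (simp add: ET_def)
  have P: "P \<in> carrier_mat m m" using E by (simp add: P_def)
  have Y: "Y \<in> carrier_mat m m" and Z: "Z \<in> carrier_mat m m"
    using P by (auto simp: Y_def Z_def minus_carrier_mat)
  have "P * P = E * (ET * (E * ET))"
    using E ET by (simp add: P_def ET_def[symmetric] assoc_mult_mat[of _ m n _ m _ m])
  also have "ET * (E * ET) = c \<cdot>\<^sub>m ET"
    using E ET EE
    by (simp add: ET_def[symmetric] assoc_mult_mat[of _ n m _ n _ m, symmetric]
        mult_smult_assoc_mat[of _ n n _ m])
  finally have PP: "P * P = c \<cdot>\<^sub>m P"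
    using E ET by (simp add: P_def ET_def[symmetric] mult_smult_distrib[of _ m n _ m])
  have "Y * (1\<^sub>m m - (1 / t) \<cdot>\<^sub>m P) = Y - (1 / t) \<cdot>\<^sub>m (Y * P)"
    using Y P by (simp add: mult_minus_distrib_mat[of _ m m _ m] mult_smult_distrib[of _ m m _ m])
  also have "Y * P = t \<cdot>\<^sub>m P"
    using P unfolding Y_def
    by (simp add: add_mult_distrib_mat[of _ m m _ _ m] mult_smult_assoc_mat[of _ m m _ m] PP t_def
        add_smult_distrib_right_mat)
  also have "Y - (1 / t) \<cdot>\<^sub>m (t \<cdot>\<^sub>m P) = s \<cdot>\<^sub>m 1\<^sub>m m"
    using P t by (intro eq_matI) (auto simp: Y_def)
  finally have YZ: "Y * Z = 1\<^sub>m m"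
    using Y P s by (auto simp: Z_def mult_smult_distrib[of _ m m _ m] minus_carrier_mat intro!: eq_matI)
  \<comment> \<open>Both \<open>I\<close> and \<open>P\<close> compress to the identity under
    \<open>F\<close>, so \<open>Z\<close> compresses to \<open>(1 / s) * (1 - 1 / t)\<close> times
    the identity.\<close>
  have ZF: "FT * (Z * F) = ((t - 1) / (s * t)) \<cdot>\<^sub>m 1\<^sub>m n"
  proof -
    have "FT * (P * F) = (FT * E) * (ET * F)"
      using E ET F FT unfolding P_def ET_def[symmetric]
      by (simp add: assoc_mult_mat[of _ n m _ n _ n] assoc_mult_mat[of _ m n _ m _ n])
    also have "\<dots> = 1\<^sub>m n" using FE EF by (simp add: FT_def ET_def)
    finally have 1: "FT * (P * F) = 1\<^sub>m n" .
    have "Z * F = (1 / s) \<cdot>\<^sub>m (F - (1 / t) \<cdot>\<^sub>m (P * F))"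
      using P F unfolding Z_def
      by (simp add: mult_smult_assoc_mat[of _ m m _ n] minus_mult_distrib_mat[of _ m m _ _ n] minus_carrier_mat)
    then have "FT * (Z * F) = (1 / s) \<cdot>\<^sub>m (1\<^sub>m n - (1 / t) \<cdot>\<^sub>m 1\<^sub>m n)"
      using P F FT 1 FF
      by (simp add: FT_def[symmetric] mult_smult_distrib[of _ n m _ n]
          mult_minus_distrib_mat[of _ n m _ n] minus_carrier_mat)
    then show ?thesis using t s by (auto intro!: eq_matI simp: field_simps)
  qed
  \<comment> \<open>As \<open>Z\<close> inverts \<open>Y\<close>, this choice gives
    \<open>Y * V = F * L\<close>, so that \<open>Y\<close> splits off on the left.\<close>
  define V where "V = Z * (F * L)"
  have V: "V \<in> carrier_mat m n" using Z F L by (auto simp: V_def)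
  have "Y * (V * FT) = F * L * FT"
  proof -
    have "Y * V = (Y * Z) * (F * L)"
      using Y Z F L by (simp add: V_def assoc_mult_mat[of _ m m _ m _ n])
    then have "Y * V = F * L" using F L by (simp add: YZ)
    then show ?thesis using Y V FT by (simp add: assoc_mult_mat[of _ m m _ n _ m, symmetric])
  qed
  then have "Y - F * L * FT = Y * (1\<^sub>m m - V * FT)"
    using Y V FT by (simp add: mult_minus_distrib_mat[of _ m m _ m])
  then have "det (Y - F * L * FT) = det Y * det (1\<^sub>m m - V * FT)"
    using Y V FT by (simp add: det_mult[of _ m] minus_carrier_mat)
  also have "det (1\<^sub>m m - V * FT) = det (1\<^sub>m n - FT * V)"
    using V FT by (rule det_one_minus_mult_commute)
  also have "FT * V = FT * (Z * F) * L"
    using FT Z F L by (simp add: V_def assoc_mult_mat[of _ n m _ n _ n] assoc_mult_mat[of _ m m _ n _ n])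
  also have "\<dots> = ((t - 1) / (s * t)) \<cdot>\<^sub>m L"
    using L by (simp add: ZF mult_smult_assoc_mat[of _ n n _ n])
  also have "det Y = s ^ m * (1 + c / s) ^ n"
    unfolding Y_def P_def using E EE s by (intro det_scaled_one_add_mult) auto
  also have "1 + c / s = t / s" using s by (simp add: t_def field_simps)
  finally show ?thesis by (simp add: Y_def P_def FT_def t_def)
qed

section \<open>The Laplacian after attaching cliques\<close>

lemma card_residue_class:
  assumes "a < (N::nat)"
  shows "card {i. i < k * N \<and> i mod N = a} = k"
proof -
  have "a + j * N < k * N" if "j < k" for j
  proof -
    have "Suc j * N \<le> k * N" using that by (intro mult_le_mono) auto
    then show ?thesis using assms by simp
  qed
  moreover have "i \<in> (\<lambda>j. a + j * N) ` {..<k}" if "i < k * N" "i mod N = a" for i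
    using that by (intro image_eqI[of _ _ "i div N"]) (auto simp: less_mult_imp_div_less)
  ultimately have "{i. i < k * N \<and> i mod N = a} = (\<lambda>j. a + j * N) ` {..<k}"
    using assms by auto
  moreover have "inj_on (\<lambda>j. a + j * N) {..<k}"
    using assms by (auto simp: inj_on_def)
  ultimately show ?thesis by (simp add: card_image)
qed

text \<open>A vertex \<open>v < N\<close> and its new vertices \<open>v + j * N\<close> make up the
  residue class of \<open>v\<close> modulo \<open>N\<close>. The new clique together with the arcs
  to and from \<open>v\<close> is therefore the complete graph on that class, with no special role
  for \<open>v\<close>.\<close>

lemma arc_attach_cliques_iff:
  assumes V: "pverts G = {..<N}" and k: "k \<ge> 1"
  shows "(u, w) \<in> parcs (attach_cliques k G) \<longleftrightarrow>
    (u, w) \<in> parcs G \<or> u < k * N \<and> w < k * N \<and> u \<noteq> w \<and> u mod N = w mod N"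
proof -
  have C: "x \<in> new_vertices N k v \<longleftrightarrow> N \<le> x \<and> x < k * N \<and> x mod N = v" if "v < N" for x v
  proof
    assume x: "x \<in> new_vertices N k v"
    have "x \<in> {..<k * N}" using union_new_vertices[OF k, of N] x that by blast
    moreover have "x \<notin> {..<N}" using new_vertices_fresh[OF that, of k] x by blast
    ultimately show "N \<le> x \<and> x < k * N \<and> x mod N = v"
      using new_vertices_mod[OF x that] by simp
  next
    assume x: "N \<le> x \<and> x < k * N \<and> x mod N = v"
    then have "x \<in> (\<Union>v\<in>{..<N}. new_vertices N k v)"
      using union_new_vertices[OF k, of N] by (metis UnE lessThan_iff not_le)
    then show "x \<in> new_vertices N k v"
      using x new_vertices_mod by blast
  qed
  have small: "x < k * N" if "x < N" for x
    by (rule less_le_trans[OF that]) (use k in simp)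
  \<comment> \<open>The only member of the class of \<open>v\<close> below \<open>N\<close> is
    \<open>v\<close> itself.\<close>
  have D: "x \<in> new_vertices N k v \<or> x = v \<longleftrightarrow> x < k * N \<and> x mod N = v" if "v < N" for x v
    using that small by (cases "x < N") (auto simp: C)
  \<comment> \<open>Arcs inside the clique, out of \<open>v\<close> and into \<open>v\<close> merge
    into one condition; freshness keeps \<open>v\<close> distinct from its new vertices.\<close>
  have "(u, w) \<in> parcs (attach_cliques k G) \<longleftrightarrow> (u, w) \<in> parcs G \<or>
      (\<exists>v<N. u \<noteq> w \<and> (u \<in> new_vertices N k v \<or> u = v) \<and> (w \<in> new_vertices N k v \<or> w = v))"
    using new_vertices_fresh[of _ N k]
    by (auto simp: attach_cliques_def complete_on_def Let_def V)
  also have "\<dots> \<longleftrightarrow> (u, w) \<in> parcs G \<or>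
      (\<exists>v<N. u \<noteq> w \<and> (u < k * N \<and> u mod N = v) \<and> (w < k * N \<and> w mod N = v))"
    by (simp only: D cong: conj_cong)
  also have "\<dots> \<longleftrightarrow> (u, w) \<in> parcs G \<or> u < k * N \<and> w < k * N \<and> u \<noteq> w \<and> u mod N = w mod N"
    by (cases "N = 0") auto
  finally show ?thesis .
qed

text \<open>The sorted vertex list is \<open>[0..<N]\<close>, so vertices serve directly as matrix
  indices.\<close>

lemma laplacian_matrix_lessThan:
  assumes "pverts G = {..<N}"
  shows "laplacian_matrix G = mat N N (\<lambda>(i, j).
    (if i = j then real (card {w. (i, w) \<in> parcs G}) else 0) - (if (i, j) \<in> parcs G then 1 else 0))"
proof -
  have vs: "sorted_list_of_set {..<N} = [0..<N]"
    by (simp add: lessThan_atLeast0)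
  have "out_degree G i = card {w. (i, w) \<in> parcs G}" for i
  proof -
    have "out_arcs (with_proj G) i = Pair i ` {w. (i, w) \<in> parcs G}"
      by (auto simp: out_arcs_def)
    then show ?thesis by (simp add: out_degree_def card_image inj_on_def)
  qed
  then show ?thesis
    by (intro eq_matI)
      (auto simp: laplacian_matrix_def degree_matrix_def adjacency_matrix_def assms vs Let_def)
qed

text \<open>The matrix \<open>E\<close> of the overview. \<open>E * transpose_mat E\<close> is the
  adjacency matrix of the disjoint copies of the complete graph, with ones on the diagonal.\<close>

definition residue_mat :: "nat \<Rightarrow> nat \<Rightarrow> real mat" where
  "residue_mat k N = mat (k * N) N (\<lambda>(i, j). if i mod N = j then 1 else 0)"

text \<open>The matrix \<open>F\<close> of the overview; conjugating by it pads a matrix with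
  zeros.\<close>

definition inclusion_mat :: "nat \<Rightarrow> nat \<Rightarrow> real mat" where
  "inclusion_mat k N = mat (k * N) N (\<lambda>(i, j). if i = j then 1 else 0)"

lemma residue_mat_carrier [simp]: "residue_mat k N \<in> carrier_mat (k * N) N"
  by (simp add: residue_mat_def)

lemma inclusion_mat_carrier [simp]: "inclusion_mat k N \<in> carrier_mat (k * N) N"
  by (simp add: inclusion_mat_def)

lemma dim_residue_inclusion_mat [simp]:
  "dim_row (residue_mat k N) = k * N" "dim_col (residue_mat k N) = N"
  "dim_row (inclusion_mat k N) = k * N" "dim_col (inclusion_mat k N) = N"
  by (simp_all add: residue_mat_def inclusion_mat_def)

text \<open>The columns are the indicators of disjoint residue classes, each with \<open>k\<close>
  elements.\<close>

lemma residue_mat_gram: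
  "transpose_mat (residue_mat k N) * residue_mat k N = real k \<cdot>\<^sub>m 1\<^sub>m N"
proof (rule eq_matI; simp add: residue_mat_def scalar_prod_def)
  fix a b assume ab: "a < N" "b < N"
  have "(\<Sum>i = 0..<k * N. (if i mod N = a then 1 else 0) * (if i mod N = b then 1 else 0)) =
      (\<Sum>i \<in> {0..<k * N}. if i mod N = a \<and> a = b then 1 else (0::real))"
    by (rule sum.cong) auto
  also have "\<dots> = (if a = b then real (card {i. i < k * N \<and> i mod N = a}) else 0)"
    by (auto simp: sum.If_cases Int_def)
  finally show "(a = b \<longrightarrow> (\<Sum>i = 0..<k * N. (if i mod N = b then 1 else 0) * (if i mod N = b then 1 else 0)) = real k) \<and>
    (a \<noteq> b \<longrightarrow> (\<Sum>i = 0..<k * N. (if i mod N = a then 1 else 0) * (if i mod N = b then 1 else 0)) = (0::real))"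
    using ab by (auto simp: card_residue_class)
qed

text \<open>Each residue class contains exactly one index below \<open>N\<close>, and it is its own
  residue.\<close>

lemma inclusion_mat_gram:
  assumes "k \<ge> 1"
  shows "transpose_mat (inclusion_mat k N) * inclusion_mat k N = 1\<^sub>m N"
    and "transpose_mat (inclusion_mat k N) * residue_mat k N = 1\<^sub>m N"
    and "transpose_mat (residue_mat k N) * inclusion_mat k N = 1\<^sub>m N"
proof -
  have small: "x < k * N" if "x < N" for x
    by (rule less_le_trans[OF that]) (use assms in simp)
  show "transpose_mat (inclusion_mat k N) * inclusion_mat k N = 1\<^sub>m N"
    by (rule eq_matI) (auto simp: inclusion_mat_def scalar_prod_def small
        if_distrib[of "\<lambda>x. x * _"] cong: if_cong)
  show FE: "transpose_mat (inclusion_mat k N) * residue_mat k N = 1\<^sub>m N"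
    by (rule eq_matI) (auto simp: inclusion_mat_def residue_mat_def scalar_prod_def small
        if_distrib[of "\<lambda>x. x * _"] cong: if_cong)
  show "transpose_mat (residue_mat k N) * inclusion_mat k N = 1\<^sub>m N"
    using arg_cong[OF FE, of transpose_mat]
    by (simp add: transpose_mult[of _ N "k * N" _ N])
qed

text \<open>Laplacians add over arc-disjoint unions. The copies of the complete graph contribute
  \<open>k I - E * transpose_mat E\<close>, and the old graph contributes its own Laplacian padded
  with zeros.\<close>

lemma laplacian_attach_cliques:
  assumes V: "pverts G = {..<N}" and arcs: "parcs G \<subseteq> {..<N} \<times> {..<N}"
    and irrefl: "irrefl (parcs G)" and k: "k \<ge> 1"
  shows "laplacian_matrix (attach_cliques k G) =
    real k \<cdot>\<^sub>m 1\<^sub>m (k * N) - residue_mat k N * transpose_mat (residue_mat k N)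
      + inclusion_mat k N * laplacian_matrix G * transpose_mat (inclusion_mat k N)"
    (is "?L' = ?R")
proof -
  let ?E = "residue_mat k N" and ?F = "inclusion_mat k N" and ?L = "laplacian_matrix G"
  have V': "pverts (attach_cliques k G) = {..<k * N}"
    using union_new_vertices[OF k, of N] by (simp add: attach_cliques_def complete_on_def Let_def V)
  have L: "?L \<in> carrier_mat N N" by (simp add: laplacian_matrix_lessThan[OF V])
  have EE: "(?E * transpose_mat ?E) $$ (i, j) = (if i mod N = j mod N then 1 else 0)"
    if "i < k * N" "j < k * N" for i j
  proof -
    have "N > 0" using that by (cases N) auto
    then show ?thesis using that
      by (simp add: residue_mat_def scalar_prod_def if_distrib[of "\<lambda>x. x * _"] cong: if_cong)
  qed
  have FL: "(?F * ?L) $$ (i, j) = (if i < N then ?L $$ (i, j) else 0)"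
    if "i < k * N" "j < N" for i j
    using that L by (simp add: inclusion_mat_def scalar_prod_def if_distrib[of "\<lambda>x. x * _"] cong: if_cong)
  have FLF: "(?F * ?L * transpose_mat ?F) $$ (i, j) = (if i < N \<and> j < N then ?L $$ (i, j) else 0)"
    if ij: "i < k * N" "j < k * N" for i j
  proof -
    have "(?F * ?L * transpose_mat ?F) $$ (i, j) = (\<Sum>a<N. (?F * ?L) $$ (i, a) * (if j = a then 1 else 0))"
      using ij L by (simp add: inclusion_mat_def scalar_prod_def lessThan_atLeast0)
    also have "\<dots> = (if i < N \<and> j < N then ?L $$ (i, j) else 0)"
      using ij by (simp add: FL if_distrib[of "\<lambda>x. _ * x"] cong: if_cong)
    finally show ?thesis .
  qed
  show ?thesis
  proof (rule eq_matI)
    fix i j assume "i < dim_row ?R" "j < dim_col ?R"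
    then have ij: "i < k * N" "j < k * N" by (simp_all add: inclusion_mat_def)
    then have "N > 0" by (cases N) auto
    have no_arc: "(x, y) \<notin> parcs G" if "x \<ge> N \<or> y \<ge> N" for x y
      using arcs that by auto
    let ?cl = "{w. w < k * N \<and> w mod N = i mod N}"
    have nbrs: "{w. (i, w) \<in> parcs (attach_cliques k G)} = {w. (i, w) \<in> parcs G} \<union> (?cl - {i})"
      using ij by (auto simp: arc_attach_cliques_iff[OF V k])
    \<comment> \<open>An arc of \<open>G\<close> joins distinct vertices below \<open>N\<close>,
      whose residues differ. Old and clique neighbours are thus disjoint and the degrees
      add.\<close>
    have "(i, w) \<notin> parcs G" if "w mod N = i mod N" for w
      using arcs irrefl that by (auto simp: irrefl_def)
    then have disj: "{w. (i, w) \<in> parcs G} \<inter> (?cl - {i}) = {}" by auto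
    have fin: "finite {w. (i, w) \<in> parcs G}"
      by (rule finite_subset[of _ "{..<N}"]) (use arcs in auto)
    have "card ?cl = k" using \<open>N > 0\<close> by (intro card_residue_class) simp
    then have "card (?cl - {i}) = k - 1" using ij by (subst card_Diff_singleton) auto
    then have deg: "real (card {w. (i, w) \<in> parcs (attach_cliques k G)}) =
        real (card {w. (i, w) \<in> parcs G}) + real k - 1"
      using disj fin k by (simp add: nbrs card_Un_disjoint of_nat_diff)
    have deg0: "card {w. (i, w) \<in> parcs G} = 0" if "i \<ge> N"
      using no_arc that by simp
    have excl: "(i, j) \<notin> parcs G" if "i mod N = j mod N"
      using arcs irrefl that by (auto simp: irrefl_def)
    have "?L' $$ (i, j) = (if i = j then real (card {w. (i, w) \<in> parcs (attach_cliques k G)}) else 0)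
        - (if (i, j) \<in> parcs (attach_cliques k G) then 1 else 0)"
      using ij by (simp add: laplacian_matrix_lessThan[OF V'])
    also have "\<dots> = (if i = j then real (card {w. (i, w) \<in> parcs G}) + real k - 1 else 0)
        - (if (i, j) \<in> parcs G \<or> i \<noteq> j \<and> i mod N = j mod N then 1 else 0)"
      unfolding deg using ij by (simp add: arc_attach_cliques_iff[OF V k])
    \<comment> \<open>The \<open>- 1\<close> in the clique degree is accounted for by the diagonal
      ones of \<open>E * transpose_mat E\<close>.\<close>
    also have "\<dots> = (if i = j then real k else 0) - (if i mod N = j mod N then 1 else 0)
        + (if i < N \<and> j < N then ?L $$ (i, j) else 0)"
      using deg0 excl no_arc by (auto simp: laplacian_matrix_lessThan[OF V] not_less)
    also have "\<dots> = ?R $$ (i, j)"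
      using ij EE[OF ij] FLF[OF ij] by (simp del: index_mult_mat(1))
    finally show "?L' $$ (i, j) = ?R $$ (i, j)" .
  qed (simp_all add: laplacian_matrix_lessThan[OF V'] inclusion_mat_def)
qed

text \<open>This is \<open>det_rank_update_compression\<close> at \<open>s = t - k\<close> and
  \<open>c = k\<close>. At \<open>t = k\<close> or \<open>t = 0\<close> one of \<open>s\<close>,
  \<open>s + c\<close> vanishes, and \<open>t = 1\<close> is the pole of the substitution.\<close>

lemma poly_char_poly_laplacian_attach_cliques:
  assumes V: "pverts G = {..<N}" and arcs: "parcs G \<subseteq> {..<N} \<times> {..<N}"
    and irrefl: "irrefl (parcs G)" and k: "k \<ge> 2" and t: "t \<noteq> 0" "t \<noteq> 1" "t \<noteq> real k"
  shows "poly (char_poly (laplacian_matrix (attach_cliques k G))) t =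
    (t - real k) ^ ((k - 2) * N) * (t - 1) ^ N *
      poly (char_poly (laplacian_matrix G)) (t * (t - real k) / (t - 1))"
proof -
  let ?E = "residue_mat k N" and ?F = "inclusion_mat k N" and ?L = "laplacian_matrix G"
  let ?m = "k * N" and ?s = "t - real k"
  define c where "c = (t - 1) / (?s * t)"
  have c: "c \<noteq> 0" using t by (simp add: c_def)
  have L: "?L \<in> carrier_mat N N" by (simp add: laplacian_matrix_lessThan[OF V])
  have k1: "k \<ge> 1" using k by simp
  note L' = laplacian_attach_cliques[OF V arcs irrefl k1]
  have "t \<cdot>\<^sub>m 1\<^sub>m ?m - laplacian_matrix (attach_cliques k G) =
      ?s \<cdot>\<^sub>m 1\<^sub>m ?m + ?E * transpose_mat ?E - ?F * ?L * transpose_mat ?F"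
    unfolding L' by (rule eq_matI) (auto simp: inclusion_mat_def residue_mat_def)
  moreover have "laplacian_matrix (attach_cliques k G) \<in> carrier_mat ?m ?m"
    unfolding L' using carrier_matD[OF inclusion_mat_carrier[of k N]] by (intro carrier_matI) simp_all
  ultimately have "poly (char_poly (laplacian_matrix (attach_cliques k G))) t =
      det (?s \<cdot>\<^sub>m 1\<^sub>m ?m + ?E * transpose_mat ?E - ?F * ?L * transpose_mat ?F)"
    by (simp add: poly_char_poly)
  also have "\<dots> = ?s ^ ?m * ((?s + real k) / ?s) ^ N *
      det (1\<^sub>m N - ((?s + real k - 1) / (?s * (?s + real k))) \<cdot>\<^sub>m ?L)"
    using k1 t by (intro det_rank_update_compression L residue_mat_gram inclusion_mat_gram) auto
  also have "\<dots> = ?s ^ ?m * (t / ?s) ^ N * det (1\<^sub>m N - c \<cdot>\<^sub>m ?L)"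
    by (simp add: c_def)
  \<comment> \<open>Pulling out \<open>c\<close> exhibits the characteristic matrix of
    \<open>G\<close> at the point \<open>1 / c\<close>.\<close>
  also have "1\<^sub>m N - c \<cdot>\<^sub>m ?L = c \<cdot>\<^sub>m ((1 / c) \<cdot>\<^sub>m 1\<^sub>m N - ?L)"
    using L c by (intro eq_matI) (auto simp: field_simps)
  also have "det \<dots> = c ^ N * poly (char_poly ?L) (1 / c)"
    using L by (simp add: poly_char_poly)
  also have "1 / c = t * ?s / (t - 1)" by (simp add: c_def mult.commute)
  also have "?s ^ ?m * (t / ?s) ^ N * (c ^ N * poly (char_poly ?L) (t * ?s / (t - 1))) =
      ?s ^ ?m * ((t / ?s) * c) ^ N * poly (char_poly ?L) (t * ?s / (t - 1))"
    by (simp only: power_mult_distrib mult.assoc)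
  also have "(t / ?s) * c = (t - 1) / ?s ^ 2"
    using t by (simp add: c_def power2_eq_square)
  \<comment> \<open>Of the \<open>k * N\<close> factors \<open>t - k\<close>, exactly
    \<open>2 * N\<close> cancel against the denominators.\<close>
  also have "?s ^ ?m = ?s ^ ((k - 2) * N) * (?s ^ 2) ^ N"
  proof -
    have "k * N = (k - 2) * N + 2 * N" using k by (metis add_mult_distrib le_add_diff_inverse2)
    then show ?thesis by (simp add: power_add power_mult)
  qed
  also have "?s ^ ((k - 2) * N) * (?s ^ 2) ^ N * ((t - 1) / ?s ^ 2) ^ N = ?s ^ ((k - 2) * N) * (t - 1) ^ N"
    using t by (simp add: power_divide)
  finally show ?thesis .
qed

section \<open>Spectra as multisets and their recursion\<close>

definition linear_factors :: "'a :: idom multiset \<Rightarrow> 'a poly" where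
  "linear_factors M = (\<Prod>x\<in>#M. [:- x, 1:])"

lemma linear_factors_empty [simp]: "linear_factors {#} = 1"
  by (simp add: linear_factors_def)

lemma linear_factors_add_mset: "linear_factors (add_mset x M) = [:- x, 1:] * linear_factors M"
  by (simp add: linear_factors_def)

lemma linear_factors_union [simp]:
  "linear_factors (M + M') = linear_factors M * linear_factors M'"
  by (simp add: linear_factors_def)

lemma poly_linear_factors_add_mset [simp]:
  "poly (linear_factors (add_mset x M)) t = (t - x) * poly (linear_factors M) t"
  by (simp add: linear_factors_add_mset algebra_simps)

lemma linear_factors_nonzero: "linear_factors M \<noteq> 0"
  by (auto simp: linear_factors_def)

text \<open>Through this, a factorization of the characteristic polynomial determines the
  eigenvalues together with their multiplicities.\<close>

lemma proots_linear_factors: "proots (linear_factors M) = M"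
proof (induction M)
  case (add x M)
  have "proots (linear_factors (add_mset x M)) = proots [:- x, 1:] + proots (linear_factors M)"
    unfolding linear_factors_add_mset by (rule proots_mult) (simp_all add: linear_factors_nonzero)
  then show ?case by (simp add: add)
qed simp

lemma poly_linear_factors_replicate:
  "poly (linear_factors (replicate_mset n x)) t = (t - x) ^ n"
  by (induction n) simp_all

text \<open>Since \<open>M\<close> is positive, the single \<open>0\<close> comes first in the
  sorted list, and the sum from index 2 runs exactly over \<open>M\<close>.\<close>

lemma coherence2_linear_factors:
  assumes char_poly: "char_poly (laplacian_matrix G) = linear_factors (add_mset 0 M)"
    and pos: "\<forall>x\<in>#M. x > 0" and size: "card (pverts G) = Suc (size M)"
  shows "coherence2 G = 1 / (2 * real (Suc (size M))) * (\<Sum>x\<in>#M. 1 / x\<^sup>2)"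
proof -
  let ?ys = "sorted_list_of_multiset M"
  have "sorted_list_of_multiset (add_mset 0 M) = 0 # ?ys"
    using pos by (simp add: insort_is_Cons less_imp_le)
  then have eig: "laplacian_eigenvalue G i = (0 # ?ys) ! (i - 1)" for i
    unfolding laplacian_eigenvalue_def char_poly proots_linear_factors by simp
  have len: "length ?ys = size M"
    by (simp flip: size_mset)
  \<comment> \<open>The shift is by two: one for counting eigenvalues from 1, one for the leading
    \<open>0\<close>.\<close>
  have "(\<Sum>i=2..Suc (size M). 1 / (laplacian_eigenvalue G i)\<^sup>2) = (\<Sum>i<size M. 1 / (?ys ! i)\<^sup>2)"
    by (rule sum.reindex_bij_witness[of _ "\<lambda>i. i + 2" "\<lambda>i. i - 2"])
      (auto simp: eig nth_Cons' numeral_2_eq_2)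
  also have "\<dots> = sum_list (map (\<lambda>x. 1 / x\<^sup>2) ?ys)"
    by (simp add: sum_list_sum_nth len lessThan_atLeast0)
  also have "\<dots> = (\<Sum>x\<in>#M. 1 / x\<^sup>2)"
    by (simp flip: sum_mset_sum_list)
  finally show ?thesis by (simp only: coherence2_def size Let_def)
qed

text \<open>These are the solutions \<open>x\<close> of \<open>x * (x - k) / (x - 1) = l\<close>.
  They are real because the discriminant is \<open>(l + k - 2)\<^sup>2 + 4 * (k - 1)\<close>, and
  positive because its root lies below \<open>l + k\<close>.\<close>

lemma quadratic_positive_roots:
  assumes "l > 0" "k \<ge> (1::real)"
  shows "\<exists>a b. a > 0 \<and> b > 0 \<and> a + b = l + k \<and> a * b = l"
proof -
  have "(l + k)\<^sup>2 - 4 * l = (l + k - 2)\<^sup>2 + 4 * (k - 1)"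
    by (simp add: power2_eq_square algebra_simps)
  then have disc: "(l + k)\<^sup>2 - 4 * l \<ge> 0" using assms by simp
  define d where "d = sqrt ((l + k)\<^sup>2 - 4 * l)"
  have d: "d\<^sup>2 = (l + k)\<^sup>2 - 4 * l" using disc by (simp add: d_def)
  have "d \<ge> 0" using disc by (simp add: d_def)
  have "d\<^sup>2 < (l + k)\<^sup>2" using assms(1) d by simp
  then have "d < l + k" by (rule power2_less_imp_less) (use assms in simp)
  have "(l + k + d) / 2 * ((l + k - d) / 2) = ((l + k)\<^sup>2 - d\<^sup>2) / 4"
    by (simp add: power2_eq_square algebra_simps)
  then have "(l + k + d) / 2 * ((l + k - d) / 2) = l" by (simp add: d)
  moreover have "(l + k + d) / 2 > 0" "(l + k - d) / 2 > 0"
    using assms \<open>d \<ge> 0\<close> \<open>d < l + k\<close> by simp_all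
  moreover have "(l + k + d) / 2 + (l + k - d) / 2 = l + k" by (simp add: field_simps)
  ultimately show ?thesis by blast
qed

text \<open>Otherwise the difference would have infinitely many roots. This removes the exceptional
  values of \<open>t\<close> from the determinant identity.\<close>

lemma poly_eqI_cofinite:
  fixes p q :: "'a :: {idom, ring_char_0} poly"
  assumes "finite S" and "\<And>t. t \<notin> S \<Longrightarrow> poly p t = poly q t"
  shows "p = q"
proof (rule ccontr)
  assume "p \<noteq> q"
  then have "finite {t. poly (p - q) t = 0}" by (intro poly_roots_finite) simp
  then have "finite ({t. poly (p - q) t = 0} \<union> S)" using assms(1) by simp
  moreover have "{t. poly (p - q) t = 0} \<union> S = UNIV" using assms(2) by auto
  ultimately show False using infinite_UNIV_char_0 by metis
qed

text \<open>Both reciprocal sums are carried along, because the recursion for the squares involves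
  the plain reciprocals.\<close>

lemma char_poly_attach_cliques_factors:
  assumes V: "pverts G = {..<N}" and arcs: "parcs G \<subseteq> {..<N} \<times> {..<N}"
    and irrefl: "irrefl (parcs G)" and k: "k \<ge> 2"
    and char_poly: "char_poly (laplacian_matrix G) = linear_factors (add_mset 0 M)"
    and pos: "\<forall>x\<in>#M. x > 0" and size: "N = Suc (size M)"
  obtains M' where
    "char_poly (laplacian_matrix (attach_cliques k G)) = linear_factors (add_mset 0 M')"
    "\<forall>x\<in>#M'. x > 0" "k * N = Suc (size M')"
    "(\<Sum>x\<in>#M'. 1 / x) = real (Suc ((k - 2) * N)) / real k + real (size M) + real k * (\<Sum>x\<in>#M. 1 / x)"
    "(\<Sum>x\<in>#M'. 1 / x\<^sup>2) = real (Suc ((k - 2) * N)) / (real k)\<^sup>2 + real (size M)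
       + 2 * (real k - 1) * (\<Sum>x\<in>#M. 1 / x) + (real k)\<^sup>2 * (\<Sum>x\<in>#M. 1 / x\<^sup>2)"
proof -
  have "\<forall>l. \<exists>a b. l > 0 \<longrightarrow> a > 0 \<and> b > 0 \<and> a + b = l + real k \<and> a * b = l"
    using quadratic_positive_roots[of _ "real k"] k by simp
  \<comment> \<open>Choosing the two roots as functions of \<open>l\<close> lets
    \<open>image_mset\<close> collect them with multiplicity.\<close>
  then obtain a b where ab: "\<And>l. l > 0 \<Longrightarrow> a l > 0 \<and> b l > 0 \<and> a l + b l = l + real k \<and> a l * b l = l"
    unfolding choice_iff by blast
  \<comment> \<open>the extra \<open>k\<close> comes from the eigenvalue \<open>0\<close>: \<open>x\<^sup>2 - k x = x (x - k)\<close>\<close>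
  define R where "R = replicate_mset (Suc ((k - 2) * N)) (real k)"
  define M' where "M' = R + (image_mset a M + image_mset b M)"
  show thesis
  proof
    show "\<forall>x\<in>#M'. x > 0"
      using pos ab k by (auto simp: M'_def R_def)
    \<comment> \<open>The count is \<open>(k - 2) * N + 1\<close> copies of \<open>k\<close> and
      \<open>2 * (N - 1)\<close> roots, in all \<open>k * N - 1\<close>.\<close>
    have "k * N = (k - 2) * N + 2 * N" using k by (metis add_mult_distrib le_add_diff_inverse2)
    then show "k * N = Suc (size M')"
      by (simp add: M'_def R_def size)
    have "(\<Sum>x\<in>#image_mset a M + image_mset b M. 1 / x) = (\<Sum>x\<in>#M. 1 / a x + 1 / b x)"
      by (simp add: sum_mset.distrib image_mset.compositionality o_def)
    also have "\<dots> = (\<Sum>x\<in>#M. 1 + real k * (1 / x))"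
    proof (intro arg_cong[of _ _ sum_mset] image_mset_cong)
      fix x assume "x \<in># M"
      then have x: "x > 0" using pos by blast
      have "1 / a x + 1 / b x = (a x + b x) / (a x * b x)"
        using ab[OF x] by (simp add: field_simps)
      also have "\<dots> = 1 + real k * (1 / x)" using ab[OF x] x by (simp add: field_simps)
      finally show "1 / a x + 1 / b x = 1 + real k * (1 / x)" .
    qed
    also have "\<dots> = real (size M) + real k * (\<Sum>x\<in>#M. 1 / x)"
      by (simp only: sum_mset.distrib sum_mset_distrib_left) simp
    finally show "(\<Sum>x\<in>#M'. 1 / x) = real (Suc ((k - 2) * N)) / real k + real (size M) + real k * (\<Sum>x\<in>#M. 1 / x)"
      by (simp add: M'_def R_def add_divide_distrib)
    have "(\<Sum>x\<in>#image_mset a M + image_mset b M. 1 / x\<^sup>2) = (\<Sum>x\<in>#M. 1 / (a x)\<^sup>2 + 1 / (b x)\<^sup>2)"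
      by (simp add: sum_mset.distrib image_mset.compositionality o_def)
    also have "\<dots> = (\<Sum>x\<in>#M. 1 + 2 * (real k - 1) * (1 / x) + (real k)\<^sup>2 * (1 / x\<^sup>2))"
    proof (intro arg_cong[of _ _ sum_mset] image_mset_cong)
      fix x assume "x \<in># M"
      then have x: "x > 0" using pos by blast
      have "a x \<noteq> 0" "b x \<noteq> 0" using ab[OF x] by auto
      \<comment> \<open>The power sum is expressed through the sum and product of the roots, which
        Vieta supplies.\<close>
      then have "1 / (a x)\<^sup>2 + 1 / (b x)\<^sup>2 = ((a x + b x)\<^sup>2 - 2 * (a x * b x)) / (a x * b x)\<^sup>2"
        by (simp add: field_simps power2_eq_square)
      also have "\<dots> = ((x + real k)\<^sup>2 - 2 * x) / x\<^sup>2"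
        using ab[OF x] by simp
      also have "\<dots> = 1 + 2 * (real k - 1) * (1 / x) + (real k)\<^sup>2 * (1 / x\<^sup>2)"
        using x by (simp add: field_simps power2_eq_square)
      finally show "1 / (a x)\<^sup>2 + 1 / (b x)\<^sup>2 = 1 + 2 * (real k - 1) * (1 / x) + (real k)\<^sup>2 * (1 / x\<^sup>2)" .
    qed
    also have "\<dots> = real (size M) + 2 * (real k - 1) * (\<Sum>x\<in>#M. 1 / x) + (real k)\<^sup>2 * (\<Sum>x\<in>#M. 1 / x\<^sup>2)"
      by (simp only: sum_mset.distrib sum_mset_distrib_left) simp
    finally show "(\<Sum>x\<in>#M'. 1 / x\<^sup>2) = real (Suc ((k - 2) * N)) / (real k)\<^sup>2 + real (size M)
       + 2 * (real k - 1) * (\<Sum>x\<in>#M. 1 / x) + (real k)\<^sup>2 * (\<Sum>x\<in>#M. 1 / x\<^sup>2)"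
      by (simp add: M'_def R_def add_divide_distrib)
    show "char_poly (laplacian_matrix (attach_cliques k G)) = linear_factors (add_mset 0 M')"
    proof (rule poly_eqI_cofinite[of "{0, 1, real k}"])
      fix t assume t: "t \<notin> {0, 1, real k}"
      define y where "y = t * (t - real k) / (t - 1)"
      have y: "(t - 1) * y = t * (t - real k)" using t by (simp add: y_def)
      \<comment> \<open>Each factor \<open>y - x\<close> absorbs one \<open>t - 1\<close> and
        becomes \<open>(t - a x) * (t - b x)\<close>.\<close>
      have factors: "(t - 1) ^ size M * poly (linear_factors M) y =
          poly (linear_factors (image_mset a M)) t * poly (linear_factors (image_mset b M)) t"
        using pos
      proof (induction M)
        case (add x M)
        then have x: "x > 0" by simp
        have "(t - 1) * (y - x) = t * t - (x + real k) * t + x"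
          using y by (simp add: algebra_simps)
        also have "\<dots> = t * t - (a x + b x) * t + a x * b x"
          using ab[OF x] by simp
        also have "\<dots> = (t - a x) * (t - b x)" by (simp add: algebra_simps)
        finally have quadratic: "(t - 1) * (y - x) = (t - a x) * (t - b x)" .
        have "(t - 1) ^ size (add_mset x M) * poly (linear_factors (add_mset x M)) y =
            ((t - 1) * (y - x)) * ((t - 1) ^ size M * poly (linear_factors M) y)"
          by (simp add: mult_ac)
        also have "\<dots> = ((t - a x) * (t - b x)) *
            (poly (linear_factors (image_mset a M)) t * poly (linear_factors (image_mset b M)) t)"
          unfolding quadratic using add by simp
        finally show ?case by (simp add: mult_ac)
      qed simp
      have "poly (char_poly (laplacian_matrix (attach_cliques k G))) t =
          (t - real k) ^ ((k - 2) * N) * (t - 1) ^ N * poly (linear_factors (add_mset 0 M)) y"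
        using t poly_char_poly_laplacian_attach_cliques[OF V arcs irrefl k, of t]
        by (simp add: char_poly y_def)
      \<comment> \<open>Of the \<open>N\<close> factors \<open>t - 1\<close>, one goes to the
        eigenvalue \<open>0\<close>, where \<open>(t - 1) * y = t * (t - k)\<close> gives the new
        roots \<open>0\<close> and \<open>k\<close>.\<close>
      also have "\<dots> = (t - real k) ^ ((k - 2) * N) * ((t - 1) * y) *
          ((t - 1) ^ size M * poly (linear_factors M) y)"
        by (simp add: size mult_ac)
      also have "\<dots> = poly (linear_factors (add_mset 0 M')) t"
        unfolding y factors by (simp add: M'_def R_def poly_linear_factors_replicate mult_ac)
      finally show "poly (char_poly (laplacian_matrix (attach_cliques k G))) t =
          poly (linear_factors (add_mset 0 M')) t" .
    qed simp
  qed
qed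

section \<open>Closed forms for the hierarchical graphs\<close>

text \<open>The dummy graph at \<open>n = 0\<close> is a single vertex, and attaching a clique to it
  gives the complete graph on \<open>k\<close> vertices. Induction can therefore start from the
  spectrum consisting of \<open>0\<close> alone.\<close>

lemma hierarchical_graph_Suc:
  assumes "k \<ge> 1"
  shows "hierarchical_graph (Suc n) k = attach_cliques k (hierarchical_graph n k)"
proof (cases n)
  case 0
  let ?G = "complete_on {..<1::nat}"
  have V: "pverts ?G = {..<1}" by (simp add: complete_on_def)
  have "pverts (attach_cliques k ?G) = {..<1} \<union> (\<Union>v\<in>{..<1}. new_vertices 1 k v)"
    by (simp add: attach_cliques_def complete_on_def Let_def)
  also have "\<dots> = {..<k}" using union_new_vertices[OF assms, of 1] by (simp only: mult_1_right)
  finally have "pverts (attach_cliques k ?G) = pverts (complete_on {..<k})"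
    by (simp add: complete_on_def)
  moreover have "(u, w) \<in> parcs (attach_cliques k ?G) \<longleftrightarrow> (u, w) \<in> parcs (complete_on {..<k})" for u w
    unfolding arc_attach_cliques_iff[OF V assms] by (auto simp: complete_on_def)
  then have "parcs (attach_cliques k ?G) = parcs (complete_on {..<k})" by auto
  ultimately have "attach_cliques k ?G = complete_on {..<k}" by (intro pair_pre_digraph.equality) simp_all
  then show ?thesis unfolding 0 hierarchical_graph.simps by (rule sym)
qed simp

text \<open>The algebra of the induction step, with \<open>q\<close> for \<open>k ^ n\<close>: the
  closed forms of both sums are inserted into the recursion for the squares.\<close>

lemma reciprocal_square_sum_step:
  fixes k q n :: real
  assumes "k > 0"
  shows "(1 + (k - 2) * q) / k\<^sup>2 + (q - 1)
       + 2 * (k - 1) * (2 * (k - 1) * n * q / k\<^sup>2 - q / k + 1 / k)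
       + k\<^sup>2 * ((k - k\<^sup>2 + q * (k\<^sup>2 - 5 * k - 6) + q\<^sup>2 * (4 * k + 6)) / (k ^ 3 * (1 + k))
         + 4 * n * (1 - k) * q / k ^ 3)
   = (k - k\<^sup>2 + k * q * (k\<^sup>2 - 5 * k - 6) + k\<^sup>2 * q\<^sup>2 * (4 * k + 6)) / (k ^ 3 * (1 + k))
      + 4 * (n + 1) * (1 - k) * (k * q) / k ^ 3"
    (is "?A + (q - 1) + 2 * (k - 1) * ?S + k\<^sup>2 * (?X / _ + ?Y / _) = ?X' / _ + ?Y' / _")
proof -
  let ?D = "k ^ 3 * (1 + k)"
  have D: "?D \<noteq> 0" using assms by simp
  \<comment> \<open>Multiplication by the common denominator is arranged so that each summand meets
    only its own denominator; a polynomial identity remains.\<close>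
  have expand: "?D * (a + (q - 1) + 2 * (k - 1) * s + k\<^sup>2 * (b + c)) =
      k * (1 + k) * (k\<^sup>2 * a) + ?D * (q - 1) + 2 * (k - 1) * (1 + k) * (k ^ 3 * s)
      + k\<^sup>2 * (?D * b) + k\<^sup>2 * (1 + k) * (k ^ 3 * c)" for a b c s
    by (simp add: algebra_simps power2_eq_square power3_eq_cube)
  have "k ^ 3 * ?S = 2 * (k - 1) * n * q * k - k\<^sup>2 * q + k\<^sup>2"
    using assms by (simp add: field_simps power2_eq_square power3_eq_cube)
  moreover have "k\<^sup>2 * ?A = 1 + (k - 2) * q" "?D * (?X / ?D) = ?X" "k ^ 3 * (?Y / k ^ 3) = ?Y"
    using assms D by simp_all
  ultimately have "?D * (?A + (q - 1) + 2 * (k - 1) * ?S + k\<^sup>2 * (?X / ?D + ?Y / k ^ 3)) =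
      k * (1 + k) * (1 + (k - 2) * q) + ?D * (q - 1)
      + 2 * (k - 1) * (1 + k) * (2 * (k - 1) * n * q * k - k\<^sup>2 * q + k\<^sup>2) + k\<^sup>2 * ?X + k\<^sup>2 * (1 + k) * ?Y"
    unfolding expand by (simp only:)
  also have "\<dots> = ?X' + (1 + k) * ?Y'"
    by (simp add: algebra_simps power2_eq_square power3_eq_cube)
  also have "\<dots> = ?D * (?X' / ?D) + (1 + k) * (k ^ 3 * (?Y' / k ^ 3))"
    using assms D by simp
  also have "\<dots> = ?D * (?X' / ?D + ?Y' / k ^ 3)"
    by (simp only: distrib_left mult_ac)
  finally show ?thesis using D by (simp only: mult_cancel_left) simp
qed

text \<open>The sum of \<open>1 / x\<^sup>2\<close> is \<open>2 * k ^ n\<close> times the coherence;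
  the sum of \<open>1 / x\<close> is included to make the induction close.\<close>

lemma hierarchical_graph_spectrum:
  assumes k: "k \<ge> 2"
  shows "\<exists>M. char_poly (laplacian_matrix (hierarchical_graph n k)) = linear_factors (add_mset 0 M) \<and>
    (\<forall>x\<in>#M. x > 0) \<and> k ^ n = Suc (size M) \<and>
    (\<Sum>x\<in>#M. 1 / x) = 2 * (real k - 1) * real n * real k ^ n / (real k)\<^sup>2 - real k ^ n / real k + 1 / real k \<and>
    (\<Sum>x\<in>#M. 1 / x\<^sup>2) = (real k - (real k)\<^sup>2 + real k ^ n * ((real k)\<^sup>2 - 5 * real k - 6)
        + real k ^ (2 * n) * (4 * real k + 6)) / (real k ^ 3 * (1 + real k))
      + 4 * real n * (1 - real k) * real k ^ n / real k ^ 3"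
proof (induction n)
  case 0
  have "laplacian_matrix (hierarchical_graph 0 k) = 0\<^sub>m 1 1"
    by (subst laplacian_matrix_lessThan[of _ 1]) (auto simp: complete_on_def)
  then have "char_poly (laplacian_matrix (hierarchical_graph 0 k)) = linear_factors {#0#}"
    by (simp add: char_poly_defs det_single linear_factors_add_mset)
  \<comment> \<open>Both sums are empty, and both closed forms vanish at
    \<open>n = 0\<close>.\<close>
  then show ?case
    using k by (intro exI[of _ "{#}"]) (simp add: field_simps)
next
  case (Suc n)
  let ?G = "hierarchical_graph n k"
  define q where "q = real k ^ n"
  have k1: "k \<ge> 1" using k by simp
  obtain M where M: "char_poly (laplacian_matrix ?G) = linear_factors (add_mset 0 M)"
    "\<forall>x\<in>#M. x > 0" "k ^ n = Suc (size M)"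
    and S1: "(\<Sum>x\<in>#M. 1 / x) = 2 * (real k - 1) * real n * real k ^ n / (real k)\<^sup>2 - real k ^ n / real k + 1 / real k"
    and S2: "(\<Sum>x\<in>#M. 1 / x\<^sup>2) = (real k - (real k)\<^sup>2 + real k ^ n * ((real k)\<^sup>2 - 5 * real k - 6)
        + real k ^ (2 * n) * (4 * real k + 6)) / (real k ^ 3 * (1 + real k))
      + 4 * real n * (1 - real k) * real k ^ n / real k ^ 3"
    using Suc.IH by blast
  obtain M' where M': "char_poly (laplacian_matrix (attach_cliques k ?G)) = linear_factors (add_mset 0 M')"
    "\<forall>x\<in>#M'. x > 0" "k * k ^ n = Suc (size M')"
    and T1: "(\<Sum>x\<in>#M'. 1 / x) = real (Suc ((k - 2) * k ^ n)) / real k + real (size M) + real k * (\<Sum>x\<in>#M. 1 / x)"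
    and T2: "(\<Sum>x\<in>#M'. 1 / x\<^sup>2) = real (Suc ((k - 2) * k ^ n)) / (real k)\<^sup>2 + real (size M)
       + 2 * (real k - 1) * (\<Sum>x\<in>#M. 1 / x) + (real k)\<^sup>2 * (\<Sum>x\<in>#M. 1 / x\<^sup>2)"
    using char_poly_attach_cliques_factors[OF pverts_hierarchical_graph[OF k1]
        hierarchical_graph_arcs(1)[OF k1] hierarchical_graph_arcs(3)[OF k1] k M] by metis
  have sM: "real (size M) = q - 1"
    using arg_cong[OF M(3), of real] by (simp add: q_def)
  have sR: "real (Suc ((k - 2) * k ^ n)) = 1 + (real k - 2) * q"
    using k by (simp add: q_def of_nat_diff)
  have q2: "real k ^ (2 * n) = q\<^sup>2" "real k ^ (2 * Suc n) = (real k)\<^sup>2 * q\<^sup>2"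
    "real k ^ Suc n = real k * q"
    by (simp_all add: q_def power_mult power2_eq_square power_mult_distrib)
  have k0: "real k > 0" using k by simp
  have real_Suc: "real (Suc n) = real n + 1" by simp
  have "(\<Sum>x\<in>#M'. 1 / x) = 2 * (real k - 1) * real (Suc n) * (real k * q) / (real k)\<^sup>2
      - real k * q / real k + 1 / real k"
    unfolding T1 S1 sM sR q_def[symmetric] using k0
    by (simp add: field_simps power2_eq_square)
  moreover have "(\<Sum>x\<in>#M'. 1 / x\<^sup>2) = (real k - (real k)\<^sup>2 + real k * q * ((real k)\<^sup>2 - 5 * real k - 6)
        + (real k)\<^sup>2 * q\<^sup>2 * (4 * real k + 6)) / (real k ^ 3 * (1 + real k))
      + 4 * real (Suc n) * (1 - real k) * (real k * q) / real k ^ 3"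
    unfolding T2 S1 S2 sM sR q2 q_def[symmetric] real_Suc
    using k0 by (rule reciprocal_square_sum_step)
  ultimately show ?case
    using M' unfolding hierarchical_graph_Suc[OF k1] q2 by (intro exI[of _ M']) simp
qed

section \<open>The coherence formula and its asymptotics\<close>

theorem mainTheorem3:
  fixes k :: nat
  assumes "k \<ge> 3"
  shows "(\<forall>n\<ge>1. card (pverts (hierarchical_graph n k)) = k ^ n \<and>
      coherence2 (hierarchical_graph n k) =
        (real k - real k ^ 2 + real k ^ n * (real k ^ 2 - 5 * real k - 6)
            + real k ^ (2 * n) * (4 * real k + 6)) / (2 * real k ^ (n + 3) * (1 + real k))
        + 2 * real n * (1 - real k) / real k ^ 3) \<and>
      (\<lambda>n. coherence2 (hierarchical_graph n k)) \<sim>[at_top]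
      (\<lambda>n. (2 * real k + 3) / (real k ^ 3 * (real k + 1))
        * real (card (pverts (hierarchical_graph n k))))"
proof -
  have k: "k \<ge> 1" "k \<ge> 2" using assms by simp_all
  have k0: "real k > 0" using assms by simp
  have card: "card (pverts (hierarchical_graph n k)) = k ^ n" for n
    using k by (intro card_hierarchical_graph)
  have H: "coherence2 (hierarchical_graph n k) =
        (real k - real k ^ 2 + real k ^ n * (real k ^ 2 - 5 * real k - 6)
            + real k ^ (2 * n) * (4 * real k + 6)) / (2 * real k ^ (n + 3) * (1 + real k))
        + 2 * real n * (1 - real k) / real k ^ 3" for n
  proof -
    obtain M where M: "char_poly (laplacian_matrix (hierarchical_graph n k)) = linear_factors (add_mset 0 M)"
      "\<forall>x\<in>#M. x > 0" "k ^ n = Suc (size M)"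
      and S2: "(\<Sum>x\<in>#M. 1 / x\<^sup>2) = (real k - (real k)\<^sup>2 + real k ^ n * ((real k)\<^sup>2 - 5 * real k - 6)
          + real k ^ (2 * n) * (4 * real k + 6)) / (real k ^ 3 * (1 + real k))
        + 4 * real n * (1 - real k) * real k ^ n / real k ^ 3"
      using hierarchical_graph_spectrum[OF k(2), of n] by blast
    have "coherence2 (hierarchical_graph n k) = 1 / (2 * real k ^ n) * (\<Sum>x\<in>#M. 1 / x\<^sup>2)"
      using coherence2_linear_factors[OF M(1,2)] card[of n] M(3) by (metis of_nat_power)
    moreover have "1 / (2 * q) * (x / (real k ^ 3 * (1 + real k)) + 4 * real n * (1 - real k) * q / real k ^ 3) =
        x / (2 * (q * real k ^ 3) * (1 + real k)) + 2 * real n * (1 - real k) / real k ^ 3"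
      if "q > 0" for q x
      using that k0 by (simp add: divide_simps)
    ultimately show ?thesis
      using k0 unfolding S2 power_add by simp
  qed
  moreover have "(\<lambda>n. coherence2 (hierarchical_graph n k)) \<sim>[at_top]
      (\<lambda>n. (2 * real k + 3) / (real k ^ 3 * (real k + 1)) * real (card (pverts (hierarchical_graph n k))))"
  proof (rule asymp_equivI')
    define r where "r = 1 / real k"
    have r: "norm r < 1" using assms by (simp add: r_def)
    let ?K = "4 * real k + 6"
    \<comment> \<open>Here \<open>q\<close> stands for \<open>k ^ n\<close> and \<open>m\<close> for
      \<open>n\<close>. Since \<open>?K = 2 * (2 * k + 3)\<close>, the leading term becomes
      \<open>1\<close>; the others are multiples of \<open>1 / q\<^sup>2\<close>,
      \<open>1 / q\<close> and \<open>m / q\<close>.\<close>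
    have ratio: "((x + q * y + q\<^sup>2 * ?K) / (2 * (q * real k ^ 3) * (1 + real k)) +
          2 * m * (1 - real k) / real k ^ 3) / (c * q) =
        1 + x / ?K * (1 / q * (1 / q)) + y / ?K * (1 / q) +
          2 * (1 - real k) * (1 + real k) / (2 * real k + 3) * (m * (1 / q))"
      if q: "q > 0" and c: "c = (2 * real k + 3) / (real k ^ 3 * (real k + 1))" for q x y m c
    proof -
      have nz: "real k \<noteq> 0" "1 + real k \<noteq> 0" "?K \<noteq> 0" using k0 by simp_all
      have c0: "c * real k ^ 3 * (1 + real k) = 2 * real k + 3"
        using nz by (simp add: c add.commute[of "real k" 1])
      have "(x + q * y + q\<^sup>2 * ?K) / (2 * (q * real k ^ 3) * (1 + real k)) / (c * q) =
          (x + q * y + q\<^sup>2 * ?K) / (2 * q\<^sup>2 * (c * real k ^ 3 * (1 + real k)))"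
        by (simp add: power2_eq_square mult_ac)
      also have "2 * q\<^sup>2 * (c * real k ^ 3 * (1 + real k)) = q\<^sup>2 * ?K"
        unfolding c0 by (simp add: algebra_simps)
      also have "(x + q * y + q\<^sup>2 * ?K) / (q\<^sup>2 * ?K) =
          x / (q\<^sup>2 * ?K) + q * y / (q\<^sup>2 * ?K) + q\<^sup>2 * ?K / (q\<^sup>2 * ?K)"
        by (simp only: add_divide_distrib)
      also have "q\<^sup>2 * ?K / (q\<^sup>2 * ?K) = 1" using q nz by simp
      also have "q * y / (q\<^sup>2 * ?K) = y / ?K * (1 / q)"
        using q by (simp add: power2_eq_square)
      also have "x / (q\<^sup>2 * ?K) = x / ?K * (1 / q * (1 / q))"
        by (simp add: power2_eq_square mult_ac)
      finally have 1: "(x + q * y + q\<^sup>2 * ?K) / (2 * (q * real k ^ 3) * (1 + real k)) / (c * q) =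
        1 + x / ?K * (1 / q * (1 / q)) + y / ?K * (1 / q)" by linarith
      have "2 * m * (1 - real k) / real k ^ 3 / (c * q) =
          2 * m * (1 - real k) / (c * real k ^ 3 * q)"
        by (simp add: mult_ac)
      also have "\<dots> = (2 * m * (1 - real k)) * (1 + real k) / ((c * real k ^ 3 * q) * (1 + real k))"
        using nz(2) by (rule mult_divide_mult_cancel_right[symmetric])
      also have "(c * real k ^ 3 * q) * (1 + real k) = (2 * real k + 3) * q"
        by (subst c0[symmetric]) (simp only: mult_ac)
      finally have 2: "2 * m * (1 - real k) / real k ^ 3 / (c * q) =
          2 * (1 - real k) * (1 + real k) / (2 * real k + 3) * (m * (1 / q))"
        by (simp add: mult_ac)
      show ?thesis unfolding add_divide_distrib[of _ _ "c * q"] 1 2 ..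
    qed
    \<comment> \<open>As \<open>r < 1\<close>, both \<open>r ^ n\<close> and
      \<open>n * r ^ n\<close> tend to zero.\<close>
    have "(\<lambda>n. 1 + (real k - real k ^ 2) / ?K * (r ^ n * r ^ n) + (real k ^ 2 - 5 * real k - 6) / ?K * r ^ n
        + 2 * (1 - real k) * (1 + real k) / (2 * real k + 3) * (real n * r ^ n))
        \<longlonglongrightarrow> 1 + (real k - real k ^ 2) / ?K * (0 * 0) + (real k ^ 2 - 5 * real k - 6) / ?K * 0
        + 2 * (1 - real k) * (1 + real k) / (2 * real k + 3) * 0"
      using r by (intro tendsto_intros LIMSEQ_power_zero powser_times_n_limit_0)
    moreover have "coherence2 (hierarchical_graph n k) /
        ((2 * real k + 3) / (real k ^ 3 * (real k + 1)) * real (card (pverts (hierarchical_graph n k)))) =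
        1 + (real k - real k ^ 2) / ?K * (r ^ n * r ^ n) + (real k ^ 2 - 5 * real k - 6) / ?K * r ^ n
        + 2 * (1 - real k) * (1 + real k) / (2 * real k + 3) * (real n * r ^ n)" for n
    proof -
      have q: "real k ^ n > 0" using k0 by simp
      have rn: "r ^ n = 1 / real k ^ n" by (simp add: r_def power_divide)
      have kn: "real k ^ (2 * n) = (real k ^ n)\<^sup>2" by (simp add: power_mult mult.commute)
      show ?thesis
        unfolding H card of_nat_power rn kn power_add by (rule ratio[OF q refl])
    qed
    ultimately show "(\<lambda>n. coherence2 (hierarchical_graph n k) /
        ((2 * real k + 3) / (real k ^ 3 * (real k + 1)) * real (card (pverts (hierarchical_graph n k))))) \<longlonglongrightarrow> 1"
      by simp
  qed
  ultimately show ?thesis using card by blast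
qed

end
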